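(* There exists an uncountable Hausdorff topological space that is separable and exponentially separable.
   Context: Given a topological space $X$ and a family $\mathcal{F}$ of subsets of $X$, a set $A\subset X$ is strongly dense in $\mathcal{F}$ if $A\cap\bigcap\mathcal{G}\neq\emptyset$ whenever $\mathcal{G}\subset\mathcal{F}$ and $\bigcap\mathcal{G}\neq\emptyset$. $X$ is exponentially separable if for every countable family $\mathcal{F}$ of closed subsets of $X$ there is a countable $A\subset X$ that is strongly dense in $\mathcal{F}$. *)

theory Defs
  imports "HOL-Analysis.Analysis"
begin

(* Intersections are taken inside topspace X, so that the intersection of the empty
   family is the whole space (as usual for families of subsets of X) rather than UNIV. *)
definition strongly_dense_in :: "'a topology \<Rightarrow> 'a set \<Rightarrow> 'a set set \<Rightarrow> bool" where
  "strongly_dense_in X A \<F> \<longleftrightarrow>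
     A \<subseteq> topspace X \<and>
     (\<forall>\<G>. \<G> \<subseteq> \<F> \<and> topspace X \<inter> \<Inter>\<G> \<noteq> {} \<longrightarrow> A \<inter> \<Inter>\<G> \<noteq> {})"

definition exponentially_separable_space :: "'a topology \<Rightarrow> bool" where
  "exponentially_separable_space X \<longleftrightarrow>
     (\<forall>\<F>. countable \<F> \<and> (\<forall>F\<in>\<F>. closedin X F) \<longrightarrow>
        (\<exists>A. countable A \<and> strongly_dense_in X A \<F>))"

(* HOL cannot quantify existentially over types, so an existence statement about
   topological spaces needs a fixed type of points. The carrier topspace X may be any
   subset of that type. For separable Hausdorff spaces the type nat set set is no
   restriction: such a space has at most 2^(2^aleph_0) points, hence is homeomorphic
   to some X :: nat set set topology. *)

end

theory Submission
  imports Defs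
begin

text \<open>
  The point is that a space with a point \<open>p\<close> all of whose neighbourhoods are co-countable is
  exponentially separable: for a countable family of closed sets take \<open>p\<close> together with all
  members of the family that miss \<open>p\<close>; these are countable, and every subfamily either has \<open>p\<close> in its
  intersection or contains one of them. To obtain a separable Hausdorff example, adjoin such a point
  to the Mrowka \<open>\<Psi>\<close>-space of the almost disjoint family of branches of the binary tree.
\<close>

section \<open>A criterion for exponential separability\<close>

lemma exponentially_separable_space_if_cocountable_nhds:
  assumes p: "p \<in> topspace X"
    and cocountable: "\<And>U. openin X U \<Longrightarrow> p \<in> U \<Longrightarrow> countable (topspace X - U)"
  shows "exponentially_separable_space X"
  unfolding exponentially_separable_space_def
proof (intro allI impI, elim conjE)
  fix \<F> assume \<F>: "countable \<F>" "\<forall>F\<in>\<F>. closedin X F"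
  define A where "A = insert p (\<Union>F\<in>{F \<in> \<F>. p \<notin> F}. F)"
  \<comment> \<open>The complement of \<open>F\<close> is an open neighbourhood of \<open>p\<close>,
    and \<open>F\<close> is what it leaves out.\<close>
  have "countable F" if "F \<in> \<F>" "p \<notin> F" for F
    using cocountable[of "topspace X - F"] that \<F> p
    by (auto simp: closedin_def double_diff)
  then have "countable A"
    using countable_subset[OF _ \<F>(1), of "{F \<in> \<F>. p \<notin> F}"]
    unfolding A_def by (intro countable_insert countable_UN) auto
  moreover have "strongly_dense_in X A \<F>"
    unfolding strongly_dense_in_def
  proof (intro conjI allI impI)
    show "A \<subseteq> topspace X"
      using p \<F>(2) closedin_subset by (fastforce simp: A_def)
    fix \<G> assume \<G>: "\<G> \<subseteq> \<F> \<and> topspace X \<inter> \<Inter>\<G> \<noteq> {}"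
    show "A \<inter> \<Inter>\<G> \<noteq> {}"
    proof (cases "p \<in> \<Inter>\<G>")
      case True
      then show ?thesis by (auto simp: A_def)
    next
      case False
      then obtain F where F: "F \<in> \<G>" "p \<notin> F" by auto
      from \<G> obtain x where x: "x \<in> \<Inter>\<G>" by auto
      have "x \<in> F" using x F(1) by (rule InterD)
      moreover have "F \<in> {F \<in> \<F>. p \<notin> F}" using F \<G> by blast
      ultimately have "x \<in> A" unfolding A_def by blast
      with x show ?thesis by blast
    qed
  qed
  ultimately show "\<exists>A. countable A \<and> strongly_dense_in X A \<F>" by blast
qed

section \<open>Almost disjoint branches of the binary tree\<close>

text \<open>
  A node of the binary tree at level \<open>n\<close> is a subset of \<open>{..<n}\<close>; adding \<open>n\<close>, the maximum, records the
  level.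
\<close>

definition node :: "nat set \<Rightarrow> nat \<Rightarrow> nat set" where
  "node S n = insert n (S \<inter> {..<n})"

definition branch :: "nat set \<Rightarrow> nat set set" where
  "branch S = range (node S)"

lemma Max_node [simp]: "Max (node S n) = n"
  unfolding node_def by (rule Max_eqI) auto

lemma finite_node [simp]: "finite (node S n)"
  by (simp add: node_def)

lemma node_eq_iff: "node S m = node T n \<longleftrightarrow> m = n \<and> S \<inter> {..<n} = T \<inter> {..<n}"
proof
  assume eq: "node S m = node T n"
  then have "m = n" by (metis Max_node)
  with eq show "m = n \<and> S \<inter> {..<n} = T \<inter> {..<n}"
    by (auto simp: node_def set_eq_iff)
qed (auto simp: node_def)

lemma infinite_branch: "infinite (branch S)"
  unfolding branch_def by (rule range_inj_infinite) (auto simp: inj_def node_eq_iff)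

lemma branch_not_singleton [simp]: "branch S \<noteq> {F}"
  using infinite_branch[of S] by auto

text \<open>If \<open>S\<close> and \<open>T\<close> differ at \<open>k\<close>, their branches have
  split above level \<open>k\<close>, so only the finitely many levels up to \<open>k\<close> can
  carry a common node.\<close>

lemma finite_branch_Int:
  assumes "S \<noteq> T"
  shows "finite (branch S \<inter> branch T)"
proof -
  obtain k where k: "k \<in> S \<longleftrightarrow> k \<notin> T" using assms by auto
  have "branch S \<inter> branch T \<subseteq> node S ` {..k}"
  proof
    fix F assume "F \<in> branch S \<inter> branch T"
    then obtain m where m: "F = node S m" "S \<inter> {..<m} = T \<inter> {..<m}"
      by (auto simp: branch_def node_eq_iff)
    then have "\<not> k < m" using k by (auto simp: set_eq_iff)
    then have "m \<le> k" by simp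
    with m show "F \<in> node S ` {..k}" by auto
  qed
  then show ?thesis by (rule finite_subset) simp
qed

lemma inj_branch: "inj branch"
  by (metis finite_branch_Int infinite_branch inf.idem injI)

section \<open>The topology of the extended Psi-space\<close>

text \<open>
  The isolated points are the singletons of finite sets, and the additional point is \<open>{}\<close>.
\<close>

definition isolated_points :: "nat set set set" where
  "isolated_points = (\<lambda>F. {F}) ` {F. finite F}"

definition psi_points :: "nat set set set" where
  "psi_points = insert {} (isolated_points \<union> range branch)"

text \<open>Singletons carry no condition, hence are isolated. A neighbourhood of a branch must
  contain almost all of its nodes, as in Psi-space, and the neighbourhoods of the extra point
  \<open>{}\<close> are made co-countable.\<close>

definition psi_open :: "nat set set set \<Rightarrow> bool" where
  "psi_open U \<longleftrightarrow> U \<subseteq> psi_points \<and>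
     (\<forall>S. branch S \<in> U \<longrightarrow> finite {F \<in> branch S. {F} \<notin> U}) \<and>
     ({} \<in> U \<longrightarrow> countable (psi_points - U))"

definition psi_space :: "nat set set topology" where
  "psi_space = topology psi_open"

lemma istopology_psi_open: "istopology psi_open"
  unfolding istopology_def
proof (intro conjI allI impI)
  fix U V assume UV: "psi_open U" "psi_open V"
  have "finite {F \<in> branch S. {F} \<notin> U \<inter> V}" if "branch S \<in> U \<inter> V" for S
  proof -
    have "{F \<in> branch S. {F} \<notin> U \<inter> V} = {F \<in> branch S. {F} \<notin> U} \<union> {F \<in> branch S. {F} \<notin> V}"
      by auto
    then show ?thesis using UV that by (auto simp: psi_open_def)
  qed
  then show "psi_open (U \<inter> V)"
    using UV by (auto simp: psi_open_def Diff_Int)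
next
  fix \<U> assume \<U>: "\<forall>U\<in>\<U>. psi_open U"
  have "finite {F \<in> branch S. {F} \<notin> \<Union>\<U>}" if "U \<in> \<U>" "branch S \<in> U" for S U
    by (rule finite_subset[of _ "{F \<in> branch S. {F} \<notin> U}"])
       (use that \<U> in \<open>auto simp: psi_open_def\<close>)
  moreover have "countable (psi_points - \<Union>\<U>)" if "U \<in> \<U>" "{} \<in> U" for U
    by (rule countable_subset[of _ "psi_points - U"])
       (use that \<U> in \<open>auto simp: psi_open_def\<close>)
  ultimately show "psi_open (\<Union>\<U>)"
    using \<U> by (auto simp: psi_open_def)
qed

lemma openin_psi_space: "openin psi_space = psi_open"
  unfolding psi_space_def by (rule topology_inverse'[OF istopology_psi_open])

lemma topspace_psi_space [simp]: "topspace psi_space = psi_points"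
proof -
  have "finite {F \<in> branch S. {F} \<notin> psi_points}" for S
    by (rule finite_subset[of _ "{}"])
       (auto simp: branch_def psi_points_def isolated_points_def)
  then have "psi_open psi_points" by (auto simp: psi_open_def)
  moreover have "U \<subseteq> psi_points" if "psi_open U" for U
    using that by (simp add: psi_open_def)
  ultimately show ?thesis
    unfolding topspace_def openin_psi_space by blast
qed

lemma countable_isolated_points: "countable isolated_points"
  unfolding isolated_points_def
  by (intro countable_image countable_Collect_finite)

lemma singleton_mem_isolated_points: "{F} \<in> isolated_points \<longleftrightarrow> finite F"
  by (auto simp: isolated_points_def)

lemma finite_mem_branch: "F \<in> branch S \<Longrightarrow> finite F"
  by (auto simp: branch_def)

section \<open>Basic neighbourhoods and Hausdorff separation\<close>

text \<open>For a branch this is the point together with all its nodes; for \<open>x = {F}\<close>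
  it collapses to \<open>{x}\<close>. One formula thus serves both kinds of nonempty points.\<close>

definition basic_nhd :: "nat set set \<Rightarrow> nat set set set" where
  "basic_nhd x = insert x ((\<lambda>F. {F}) ` x)"

lemma branch_mem_basic_nhd: "branch S \<in> basic_nhd x \<longleftrightarrow> x = branch S"
  by (auto simp: basic_nhd_def)

lemma singleton_mem_basic_nhd: "{F} \<in> basic_nhd x \<longleftrightarrow> x = {F} \<or> F \<in> x"
  by (auto simp: basic_nhd_def)

lemma psi_points_subset: "x \<in> psi_points \<Longrightarrow> x \<subseteq> {F. finite F}"
  by (auto simp: psi_points_def isolated_points_def dest: finite_mem_branch)

lemma countable_basic_nhd:
  assumes "x \<in> psi_points"
  shows "countable (basic_nhd x)"
proof -
  have "countable x"
    using psi_points_subset[OF assms] countable_Collect_finite by (rule countable_subset)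
  then show ?thesis by (simp add: basic_nhd_def)
qed

lemma basic_nhd_subset:
  assumes "x \<in> psi_points"
  shows "basic_nhd x \<subseteq> psi_points"
proof -
  have "{F} \<in> psi_points" if "F \<in> x" for F
    using psi_points_subset[OF assms] that
    by (auto simp: psi_points_def singleton_mem_isolated_points)
  with assms show ?thesis by (auto simp: basic_nhd_def)
qed

lemma finite_branch_Int_point:
  assumes "x \<in> psi_points" "x \<noteq> branch S"
  shows "finite (branch S \<inter> x)"
proof (cases "x \<in> range branch")
  case True
  then obtain T where "x = branch T" by blast
  with assms(2) show ?thesis using finite_branch_Int[of S T] by metis
next
  case False
  with assms(1) show ?thesis by (auto simp: psi_points_def isolated_points_def)
qed

text \<open>The only branch that can lie in the set is \<open>x\<close>, with all its nodes;
  \<open>x \<noteq> {}\<close> keeps the extra point out, so co-countability is not at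
  issue.\<close>

lemma psi_open_basic_nhd:
  assumes x: "x \<in> psi_points" "x \<noteq> {}"
  shows "psi_open (basic_nhd x)"
proof -
  have "finite {F \<in> branch S. {F} \<notin> basic_nhd x}" if "branch S \<in> basic_nhd x" for S
    using that unfolding branch_mem_basic_nhd singleton_mem_basic_nhd by simp
  moreover have "{} \<notin> basic_nhd x"
    using x by (auto simp: basic_nhd_def)
  ultimately show ?thesis
    using basic_nhd_subset[OF x(1)] by (auto simp: psi_open_def)
qed

text \<open>By almost disjointness, any other branch loses only finitely many nodes; the extra point
  keeps a co-countable neighbourhood because \<open>basic_nhd x\<close> is countable.\<close>

lemma psi_open_Compl_basic_nhd:
  assumes x: "x \<in> psi_points"
  shows "psi_open (psi_points - basic_nhd x)"
proof -
  have "finite {F \<in> branch S. {F} \<notin> psi_points - basic_nhd x}"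
    if "branch S \<in> psi_points - basic_nhd x" for S
  proof (rule finite_subset)
    show "{F \<in> branch S. {F} \<notin> psi_points - basic_nhd x} \<subseteq> branch S \<inter> x"
    proof
      fix F assume F: "F \<in> {F \<in> branch S. {F} \<notin> psi_points - basic_nhd x}"
      \<comment> \<open>Nodes are finite, so \<open>{F}\<close> is a point; it can only be missing
        because it lies in \<open>basic_nhd x\<close>, which forces
        \<open>F \<in> x\<close>.\<close>
      then have "finite F" by (auto dest: finite_mem_branch)
      then have "{F} \<in> psi_points"
        by (simp add: psi_points_def singleton_mem_isolated_points)
      with F show "F \<in> branch S \<inter> x"
        by (auto simp: singleton_mem_basic_nhd)
    qed
    show "finite (branch S \<inter> x)"
      using that x by (intro finite_branch_Int_point) (auto simp: branch_mem_basic_nhd)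
  qed
  moreover have "countable (psi_points - (psi_points - basic_nhd x))"
    using countable_basic_nhd[OF x] by (rule countable_subset[rotated]) auto
  ultimately show ?thesis by (simp add: psi_open_def)
qed

lemma Hausdorff_psi_space: "Hausdorff_space psi_space"
  unfolding Hausdorff_space_def topspace_psi_space openin_psi_space
proof (intro allI impI, elim conjE)
  \<comment> \<open>For \<open>x \<noteq> {}\<close> the set \<open>basic_nhd x\<close> is clopen,
    so it and its complement separate \<open>x\<close> from any point outside.\<close>
  have sep: "\<exists>U V. psi_open U \<and> psi_open V \<and> x \<in> U \<and> y \<in> V \<and> disjnt U V"
    if "x \<in> psi_points" "x \<noteq> {}" "y \<in> psi_points" "y \<notin> basic_nhd x" for x y
  proof (intro exI conjI)
    show "psi_open (basic_nhd x)" by (rule psi_open_basic_nhd[OF that(1,2)])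
    show "psi_open (psi_points - basic_nhd x)" by (rule psi_open_Compl_basic_nhd[OF that(1)])
    show "x \<in> basic_nhd x" by (simp add: basic_nhd_def)
    show "y \<in> psi_points - basic_nhd x" using that by simp
    show "disjnt (basic_nhd x) (psi_points - basic_nhd x)" by (auto simp: disjnt_def)
  qed
  fix x y :: "nat set set" assume xy: "x \<in> psi_points" "y \<in> psi_points" "x \<noteq> y"
  \<comment> \<open>If \<open>x \<noteq> {}\<close> and \<open>y\<close> lies in
    \<open>basic_nhd x\<close>, then \<open>y\<close> is a singleton, so
    \<open>basic_nhd y = {y}\<close> omits \<open>x\<close>. If \<open>x = {}\<close>, then
    \<open>y\<close> is nonempty and so are all members of \<open>basic_nhd y\<close>.\<close>
  consider "x \<noteq> {}" "y \<notin> basic_nhd x" | "y \<noteq> {}" "x \<notin> basic_nhd y"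
    using xy by (auto simp: basic_nhd_def)
  then show "\<exists>U V. psi_open U \<and> psi_open V \<and> x \<in> U \<and> y \<in> V \<and> disjnt U V"
  proof cases
    case 1
    with sep xy show ?thesis by blast
  next
    case 2
    with sep[of y x] xy show ?thesis by (metis disjnt_sym)
  qed
qed

section \<open>Separability and uncountability\<close>

lemma separable_psi_space: "separable_space psi_space"
  unfolding separable_space_def
proof (intro exI conjI)
  \<comment> \<open>With \<open>{}\<close> placed in the countable set, only the branches remain to
    be shown in its closure.\<close>
  let ?D = "insert {} isolated_points"
  show "countable ?D" using countable_isolated_points by simp
  show "?D \<subseteq> topspace psi_space" by (auto simp: psi_points_def)
  have "branch S \<in> psi_space closure_of ?D" for S
    unfolding in_closure_of openin_psi_space topspace_psi_space
  proof (intro conjI allI impI)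
    show "branch S \<in> psi_points" by (simp add: psi_points_def)
    fix U assume "branch S \<in> U \<and> psi_open U"
    then have "finite {F \<in> branch S. {F} \<notin> U}" by (auto simp: psi_open_def)
    \<comment> \<open>An infinite branch cannot lose all its nodes, so \<open>U\<close> contains an
      isolated point.\<close>
    then have "{F \<in> branch S. {F} \<notin> U} \<noteq> branch S" using infinite_branch by metis
    then show "\<exists>y. y \<in> ?D \<and> y \<in> U"
      using finite_mem_branch singleton_mem_isolated_points by blast
  qed
  moreover have "?D \<subseteq> psi_space closure_of ?D"
    by (rule closure_of_subset) (auto simp: psi_points_def)
  ultimately show "psi_space closure_of ?D = topspace psi_space"
    using closure_of_subset_topspace[of psi_space ?D] by (auto simp: psi_points_def)
qed

lemma uncountable_psi_points: "uncountable psi_points"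
proof
  assume "countable psi_points"
  then have "countable (range branch)"
    by (rule countable_subset[rotated]) (auto simp: psi_points_def)
  then have "countable (UNIV :: nat set set)"
    using inj_branch by (rule countable_image_inj_on)
  then obtain f :: "nat \<Rightarrow> nat set" where "range f = UNIV"
    using uncountable_def[of "UNIV :: nat set set"] by auto
  then show False using Cantors_theorem[of "UNIV :: nat set"] by (metis Pow_UNIV)
qed

theorem theorem22:
  shows "\<exists>X :: nat set set topology.
           uncountable (topspace X) \<and> Hausdorff_space X \<and>
           separable_space X \<and> exponentially_separable_space X"
proof (intro exI conjI)
  show "uncountable (topspace psi_space)" using uncountable_psi_points by simp
  \<comment> \<open>The last clause of \<open>psi_open\<close> is exactly the co-countability that
    the criterion asks for at \<open>{}\<close>.\<close>
  show "exponentially_separable_space psi_space"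
    by (rule exponentially_separable_space_if_cocountable_nhds[of "{}"])
       (auto simp: openin_psi_space psi_open_def psi_points_def)
qed (fact Hausdorff_psi_space separable_psi_space)+

end
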